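(* Let $\mathbf{B}$ be an incomplete or complete $n\times n$ additive (skew-symmetric) pairwise comparison matrix whose associated graph $G$ is connected. Let $T^1,\dots,T^S$ be all the spanning trees of $G$, and for each $s=1,\dots,S$ let $\mathbf{y}^s\in\mathbb{R}^n$ be the weight vector calculated from $T^s$ and scaled by $y^s_1=0$, i.e. the unique vector with $y^s_1=0$ and $y^s_i-y^s_j=b_{ij}$ for every edge $\{i,j\}$ of $T^s$. Then the optimal solution $\mathbf{y}^{LS}$ of the least squares problem $$\min \sum_{\substack{i,j:\\ b_{ij}\text{ is known}}}\left(b_{ij}-y_i+y_j\right)^2\qquad\text{subject to } y_1=0,$$ where the minimum is over $\mathbf{y}\in\mathbb{R}^n$, is equal to the arithmetic mean of the weight vectors calculated from all spanning trees: $$\mathbf{y}^{LS}=\frac1S\sum_{s=1}^S\mathbf{y}^s .$$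
   Context: An incomplete or complete additive pairwise comparison matrix of size $n\times n$ is an array $\mathbf{B}=[b_{ij}]_{i,j=1,\dots,n}$ in which each entry is either a known real number or missing, such that the diagonal entries are known and equal to $0$, $b_{ij}$ is known if and only if $b_{ji}$ is known, and $b_{ij}=-b_{ji}$ for all known entries. "Incomplete" means "not necessarily complete": the number of missing entries may be zero. The graph $G$ associated with $\mathbf{B}$ is the undirected simple graph on the node set $\{1,\dots,n\}$ in which distinct nodes $i$ and $j$ are joined by an edge if and only if $b_{ij}$ is known. Spanning trees are counted as labelled subgraphs of $G$, that is, distinct edge sets give distinct spanning trees. "The optimal solution" means the unique minimizer of the stated problem. *)

theory Defs
  imports Complex_Main "HOL-Library.FuncSet"
begin

section \<open>Finite simple graphs\<close>

text \<open>
  A simple graph is a vertex set \<open>V\<close> together with a set \<open>E\<close> of two-element subsets of \<open>V\<close>.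
  Undirected trees are defined here because \<open>tree\<close> in the AFP entry \<open>Graph_Theory\<close> only excludes
  directed cycles: it accepts a transitive triangle, and rejects every symmetric digraph that
  has an edge.
\<close>

definition adjacency :: "'a set set \<Rightarrow> ('a \<times> 'a) set" where
  "adjacency E = {(u, v). {u, v} \<in> E}"

definition connected_graph :: "'a set \<Rightarrow> 'a set set \<Rightarrow> bool" where
  "connected_graph V E \<longleftrightarrow> V \<noteq> {} \<and> (\<forall>u\<in>V. \<forall>v\<in>V. (u, v) \<in> (adjacency E)\<^sup>*)"

text \<open>A cycle is listed by its vertices, without repeating the first one at the end.\<close>

definition graph_cycle :: "'a set set \<Rightarrow> 'a list \<Rightarrow> bool" where
  "graph_cycle E p \<longleftrightarrow> 3 \<le> length p \<and> distinct p \<and>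
     (\<forall>k<length p. {p ! k, p ! (Suc k mod length p)} \<in> E)"

definition tree_graph :: "'a set \<Rightarrow> 'a set set \<Rightarrow> bool" where
  "tree_graph V T \<longleftrightarrow> connected_graph V T \<and> \<not> (\<exists>p. graph_cycle T p)"

definition spanning_trees :: "'a set \<Rightarrow> 'a set set \<Rightarrow> 'a set set set" where
  "spanning_trees V E = {T. T \<subseteq> E \<and> tree_graph V T}"


section \<open>Incomplete additive pairwise comparison matrices\<close>

text \<open>
  An \<open>n \<times> n\<close> array is a function of two indices, of which only the values on \<open>{1..n}\<close> matter;
  \<open>None\<close> is a missing entry.
\<close>

type_synonym incomplete_matrix = "nat \<Rightarrow> nat \<Rightarrow> real option"

definition additive_pcm :: "nat \<Rightarrow> incomplete_matrix \<Rightarrow> bool" where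
  "additive_pcm n B \<longleftrightarrow>
     (\<forall>i\<in>{1..n}. B i i = Some 0) \<and>
     (\<forall>i\<in>{1..n}. \<forall>j\<in>{1..n}. B i j \<noteq> None \<longleftrightarrow> B j i \<noteq> None) \<and>
     (\<forall>i\<in>{1..n}. \<forall>j\<in>{1..n}. \<forall>b c. B i j = Some b \<longrightarrow> B j i = Some c \<longrightarrow> b = - c)"

definition pcm_edges :: "nat \<Rightarrow> incomplete_matrix \<Rightarrow> nat set set" where
  "pcm_edges n B = {{i, j} | i j. i \<in> {1..n} \<and> j \<in> {1..n} \<and> i \<noteq> j \<and> B i j \<noteq> None}"

abbreviation pcm_trees :: "nat \<Rightarrow> incomplete_matrix \<Rightarrow> nat set set set" where
  "pcm_trees n B \<equiv> spanning_trees {1..n} (pcm_edges n B)"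

text \<open>
  \<open>\<real>\<^sup>n\<close> is the set of extensional functions on \<open>{1..n}\<close>, so that vectors with equal
  components are equal.  The vectors below are normalized by \<open>y\<^sub>1 = 0\<close>.
\<close>

definition normalized_vectors :: "nat \<Rightarrow> (nat \<Rightarrow> real) set" where
  "normalized_vectors n = {y \<in> {1..n} \<rightarrow>\<^sub>E UNIV. y 1 = 0}"

definition is_tree_weight_vector ::
    "nat \<Rightarrow> incomplete_matrix \<Rightarrow> nat set set \<Rightarrow> (nat \<Rightarrow> real) \<Rightarrow> bool" where
  "is_tree_weight_vector n B T y \<longleftrightarrow> y \<in> normalized_vectors n \<and>
     (\<forall>i j. {i, j} \<in> T \<longrightarrow> B i j = Some (y i - y j))"

definition tree_weight_vector ::
    "nat \<Rightarrow> incomplete_matrix \<Rightarrow> nat set set \<Rightarrow> nat \<Rightarrow> real" where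
  "tree_weight_vector n B T = (THE y. is_tree_weight_vector n B T y)"

text \<open>The sum runs over ordered pairs, so each off-diagonal comparison is counted twice.\<close>

definition ls_objective :: "nat \<Rightarrow> incomplete_matrix \<Rightarrow> (nat \<Rightarrow> real) \<Rightarrow> real" where
  "ls_objective n B y =
     (\<Sum>(i, j) \<in> {(i, j). i \<in> {1..n} \<and> j \<in> {1..n} \<and> B i j \<noteq> None}.
        (the (B i j) - y i + y j)\<^sup>2)"

definition is_ls_solution :: "nat \<Rightarrow> incomplete_matrix \<Rightarrow> (nat \<Rightarrow> real) \<Rightarrow> bool" where
  "is_ls_solution n B y \<longleftrightarrow> is_arg_min (ls_objective n B) (\<lambda>z. z \<in> normalized_vectors n) y"

definition ls_solution :: "nat \<Rightarrow> incomplete_matrix \<Rightarrow> nat \<Rightarrow> real" where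
  "ls_solution n B = (THE y. is_ls_solution n B y)"

end

theory Submission
  imports Defs
begin

text \<open>
  The least squares problem is convex, and its solution is characterized by the normal
  equations: at each vertex \<open>i\<close>, the residuals \<open>b i j - z i + z j\<close> over the neighbours \<open>j\<close> of \<open>i\<close>
  sum to \<open>0\<close> (\<open>sum_squares_decomposition\<close>; connectedness gives uniqueness in
  \<open>ls_solution_iff_mean\<close>).  These equations are affine in \<open>z\<close>, so the mean of the tree vectors
  satisfies them if for each \<open>i\<close> the residuals at \<open>i\<close> of all tree vectors together sum to \<open>0\<close>.
  A single tree vector usually does not satisfy them; the cancellation is between trees.

  Fix \<open>i\<close>, a spanning tree \<open>T\<close> and an edge \<open>{i, j}\<close> of the graph.  If \<open>{i, j}\<close> is in \<open>T\<close>, its residual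
  is \<open>0\<close>.  Otherwise \<open>T + {i, j}\<close> contains one cycle, which passes through \<open>i\<close> by \<open>{i, j}\<close> and by
  another edge \<open>{i, k}\<close>, the first step of the walk in \<open>T\<close> from \<open>i\<close> to \<open>j\<close>; the residual is the sum
  of \<open>b\<close> around this cycle.  Now \<open>T' = T - {i, k} + {i, j}\<close> is again a spanning tree
  (\<open>exchange_edge_spanning_tree\<close>), and the residual of \<open>T'\<close> at the edge \<open>{i, k}\<close> is the sum around
  the same cycle in the opposite direction (\<open>exchange_edge_residual\<close>).  The exchange is an
  involution on the pairs of a tree and an edge at \<open>i\<close>, so everything cancels
  (\<open>sum_tree_residuals_eq_0\<close>).
\<close>

section \<open>Walks\<close>

lemma adjacency_sym: "(u, v) \<in> adjacency E \<Longrightarrow> (v, u) \<in> adjacency E"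
  by (simp add: adjacency_def insert_commute)

lemma walk_sym: "(u, v) \<in> (adjacency E)\<^sup>* \<Longrightarrow> (v, u) \<in> (adjacency E)\<^sup>*"
  by (meson adjacency_sym symD symI sym_rtrancl)

lemma walk_mono: "(u, v) \<in> (adjacency E)\<^sup>* \<Longrightarrow> E \<subseteq> F \<Longrightarrow> (u, v) \<in> (adjacency F)\<^sup>*"
  by (erule rtrancl_mono[THEN subsetD, rotated]) (auto simp: adjacency_def)

lemma edge_walk: "{u, v} \<in> E \<Longrightarrow> (u, v) \<in> (adjacency E)\<^sup>*"
  by (auto simp: adjacency_def)

lemma walk_replace_edges:
  assumes "(u, v) \<in> (adjacency E)\<^sup>*"
    and "\<And>x y. {x, y} \<in> E \<Longrightarrow> (x, y) \<in> (adjacency F)\<^sup>*"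
  shows "(u, v) \<in> (adjacency F)\<^sup>*"
  using assms(1) by (induction rule: rtrancl_induct)
    (auto simp: adjacency_def dest: assms(2) intro: rtrancl_trans)

text \<open>A walk that needs the new edge can be shortened until it uses this edge only once.\<close>

lemma walk_insert_edge:
  assumes "(x, y) \<in> (adjacency (insert {u, v} E))\<^sup>*"
  shows "(x, y) \<in> (adjacency E)\<^sup>*
    \<or> (x, u) \<in> (adjacency E)\<^sup>* \<and> (v, y) \<in> (adjacency E)\<^sup>*
    \<or> (x, v) \<in> (adjacency E)\<^sup>* \<and> (u, y) \<in> (adjacency E)\<^sup>*"
  using assms
proof (induction rule: rtrancl_induct)
  case (step y z)
  consider "{y, z} \<in> E" | "y = u" "z = v" | "y = v" "z = u"
    using step.hyps(2) by (auto simp: adjacency_def doubleton_eq_iff)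
  then show ?case
  proof cases
    case 1
    then show ?thesis using step.IH edge_walk[OF 1] by (meson rtrancl_trans)
  next
    case 2
    then show ?thesis using step.IH by blast
  next
    case 3
    then show ?thesis using step.IH by blast
  qed
qed simp

lemma simple_path_of_walk:
  assumes "(u, v) \<in> r\<^sup>*"
  shows "\<exists>p. p \<noteq> [] \<and> hd p = u \<and> last p = v \<and> distinct p \<and> successively (\<lambda>x y. (x, y) \<in> r) p"
  using assms
proof (induction rule: rtrancl_induct)
  case base
  show ?case by (rule exI[of _ "[u]"]) simp
next
  case (step v w)
  then obtain p where p: "p \<noteq> []" "hd p = u" "last p = v" "distinct p"
    "successively (\<lambda>x y. (x, y) \<in> r) p" by blast
  show ?case
  proof (cases "w \<in> set p")
    case True
    then obtain a b where ab: "p = a @ w # b" by (meson split_list)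
    show ?thesis
      using p ab by (intro exI[of _ "a @ [w]"]) (auto simp: successively_append_iff hd_append)
  next
    case False
    show ?thesis
      using p False step.hyps by (intro exI[of _ "p @ [w]"]) (auto simp: successively_append_iff)
  qed
qed

section \<open>Forests and spanning trees\<close>

text \<open>
  Acyclicity in the form "every edge is a bridge".  Exchanging edges is then a
  statement about walks, and no list of vertices has to be manipulated.  A loop never counts as
  a bridge, since the empty walk joins its ends, whereas a \<open>graph_cycle\<close> has at least three
  vertices; the two notions therefore agree on graphs without loops.
\<close>

definition all_bridges :: "'a set set \<Rightarrow> bool" where
  "all_bridges T \<longleftrightarrow> (\<forall>u v. {u, v} \<in> T \<longrightarrow> (u, v) \<notin> (adjacency (T - {{u, v}}))\<^sup>*)"

lemma all_bridgesD: "all_bridges T \<Longrightarrow> {u, v} \<in> T \<Longrightarrow> (u, v) \<notin> (adjacency (T - {{u, v}}))\<^sup>*"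
  unfolding all_bridges_def by blast

text \<open>A simple path that joins the ends of an edge without using it closes up to a cycle.\<close>

lemma all_bridges_if_acyclic:
  assumes "\<not> (\<exists>p. graph_cycle T p)" and loopless: "\<And>u. {u} \<notin> T"
  shows "all_bridges T"
  unfolding all_bridges_def
proof (intro allI impI notI)
  fix u v
  assume uv: "{u, v} \<in> T" and w: "(u, v) \<in> (adjacency (T - {{u, v}}))\<^sup>*"
  from simple_path_of_walk[OF w] obtain p where p: "p \<noteq> []" "hd p = u" "last p = v" "distinct p"
    "successively (\<lambda>x y. (x, y) \<in> adjacency (T - {{u, v}})) p"
    by blast
  have "u \<noteq> v" using uv loopless[of u] by auto
  have step: "{p ! k, p ! Suc k} \<in> T - {{u, v}}" if "Suc k < length p" for k
    using p(5) that by (auto simp: successively_conv_nth adjacency_def)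
  have ends: "p ! 0 = u" "p ! (length p - 1) = v"
    using p by (auto simp: hd_conv_nth last_conv_nth)
  have "length p \<noteq> 0" "length p \<noteq> 1" using p ends \<open>u \<noteq> v\<close> by auto
  moreover have "length p \<noteq> 2" using step[of 0] ends by auto
  ultimately have "3 \<le> length p" by linarith
  moreover have "{p ! k, p ! (Suc k mod length p)} \<in> T" if "k < length p" for k
  proof (cases "Suc k < length p")
    case True
    then show ?thesis using step[of k] by simp
  next
    case False
    then have "Suc k = length p" using that by simp
    then show ?thesis using ends uv by (simp add: insert_commute flip: \<open>Suc k = length p\<close>)
  qed
  ultimately have "graph_cycle T p" using p(4) by (simp add: graph_cycle_def)
  then show False using assms(1) by blast
qed

text \<open>No edge of a cycle is a bridge; the proof takes the one that closes the list of vertices.\<close>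

lemma acyclic_if_all_bridges:
  assumes "all_bridges T"
  shows "\<not> graph_cycle T p"
proof
  assume c: "graph_cycle T p"
  define m where "m = length p"
  have m: "3 \<le> m" and dist: "distinct p"
    and edge: "\<And>k. k < m \<Longrightarrow> {p ! k, p ! (Suc k mod m)} \<in> T"
    using c by (auto simp: graph_cycle_def m_def)
  define e where "e = {p ! 0, p ! (m - 1)}"
  have walk: "(p ! 0, p ! k) \<in> (adjacency (T - {e}))\<^sup>*" if "k < m" for k
    using that
  proof (induction k)
    case (Suc k)
    have "{p ! k, p ! Suc k} \<in> T" using edge[of k] Suc.prems by simp
    \<comment> \<open>As \<open>m \<ge> 3\<close>, no two consecutive positions before the last are \<open>0\<close> and \<open>m - 1\<close>.\<close>
    moreover have "{p ! k, p ! Suc k} \<noteq> e"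
    proof -
      have "p ! k = p ! l \<longleftrightarrow> k = l" "p ! Suc k = p ! l \<longleftrightarrow> Suc k = l" if "l < m" for l
        using that Suc.prems dist by (simp_all add: nth_eq_iff_index_eq m_def)
      from this[of 0] this[of "m - 1"] show ?thesis
        using m unfolding e_def doubleton_eq_iff by linarith
    qed
    ultimately have "{p ! k, p ! Suc k} \<in> T - {e}" by simp
    then show ?case using Suc edge_walk by (metis Suc_lessD rtrancl_trans)
  qed simp
  have "e \<in> T" using edge[of "m - 1"] m by (simp add: e_def insert_commute)
  then show False
    using all_bridgesD[OF assms, of "p ! 0" "p ! (m - 1)"] walk[of "m - 1"] m by (simp add: e_def)
qed

lemma tree_graph_iff_all_bridges:
  assumes "\<And>u. {u} \<notin> T"
  shows "tree_graph V T \<longleftrightarrow> connected_graph V T \<and> all_bridges T"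
  unfolding tree_graph_def
  using all_bridges_if_acyclic[of T] acyclic_if_all_bridges[of T] assms by blast

lemma all_bridges_subset: "all_bridges T \<Longrightarrow> F \<subseteq> T \<Longrightarrow> all_bridges F"
  unfolding all_bridges_def by (meson Diff_mono order_refl subsetD walk_mono)

text \<open>
  If an old edge \<open>{x, y}\<close> stopped being a bridge, a walk from \<open>x\<close> to \<open>y\<close> would have to use the new
  edge \<open>{u, v}\<close>; its remaining parts and \<open>{x, y}\<close> would connect \<open>u\<close> with \<open>v\<close> in \<open>F\<close>.
\<close>

lemma all_bridges_insert:
  assumes F: "all_bridges F" and uv: "(u, v) \<notin> (adjacency F)\<^sup>*"
  shows "all_bridges (insert {u, v} F)"
  unfolding all_bridges_def
proof (intro allI impI notI)
  fix x y
  assume xy: "{x, y} \<in> insert {u, v} F"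
    and w: "(x, y) \<in> (adjacency (insert {u, v} F - {{x, y}}))\<^sup>*"
  show False
  proof (cases "{x, y} = {u, v}")
    case True
    then have "(x, y) \<in> (adjacency F)\<^sup>*" using w by (auto elim: walk_mono)
    then have "(u, v) \<in> (adjacency F)\<^sup>*"
      using True walk_sym by (metis doubleton_eq_iff)
    then show False using uv by simp
  next
    case False
    let ?H = "F - {{x, y}}"
    have "{x, y} \<in> F" using xy False by simp
    have up: "(a, c) \<in> (adjacency F)\<^sup>*" if "(a, c) \<in> (adjacency ?H)\<^sup>*" for a c
      using that by (rule walk_mono) blast
    have "insert {u, v} F - {{x, y}} = insert {u, v} ?H" using False by auto
    then have "(x, y) \<in> (adjacency ?H)\<^sup>*
      \<or> (x, u) \<in> (adjacency ?H)\<^sup>* \<and> (v, y) \<in> (adjacency ?H)\<^sup>*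
      \<or> (x, v) \<in> (adjacency ?H)\<^sup>* \<and> (u, y) \<in> (adjacency ?H)\<^sup>*"
      using walk_insert_edge w by simp
    moreover have "(x, y) \<notin> (adjacency ?H)\<^sup>*"
      using all_bridgesD[OF F \<open>{x, y} \<in> F\<close>] .
    moreover have "(x, y) \<in> (adjacency F)\<^sup>*" "(y, x) \<in> (adjacency F)\<^sup>*"
      using edge_walk[OF \<open>{x, y} \<in> F\<close>] walk_sym by auto
    ultimately have "(u, v) \<in> (adjacency F)\<^sup>*"
      using up walk_sym by (meson rtrancl_trans)
    then show False using uv by simp
  qed
qed

text \<open>
  A connected spanning subgraph with as few edges as possible is a tree, because deleting an edge
  that is not a bridge would preserve connectedness.
\<close>

lemma spanning_tree_exists:
  assumes "finite E" and loopless: "\<And>u. {u} \<notin> E" and conn: "connected_graph V E"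
  shows "spanning_trees V E \<noteq> {}"
proof -
  define P where "P T \<longleftrightarrow> T \<subseteq> E \<and> connected_graph V T" for T
  have "P E" using conn by (simp add: P_def)
  then obtain T where T: "P T" and min: "\<And>T'. P T' \<Longrightarrow> card T \<le> card T'"
    using ex_has_least_nat[of P E card] by blast
  have "finite T" using T assms(1) by (auto simp: P_def intro: finite_subset)
  have "all_bridges T"
    unfolding all_bridges_def
  proof (intro allI impI notI)
    fix u v
    assume uv: "{u, v} \<in> T" and w: "(u, v) \<in> (adjacency (T - {{u, v}}))\<^sup>*"
    have "(x, y) \<in> (adjacency (T - {{u, v}}))\<^sup>*" if "{x, y} \<in> T" for x y
    proof (cases "{x, y} = {u, v}")
      case True
      then show ?thesis using w walk_sym by (metis doubleton_eq_iff)
    next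
      case False
      then show ?thesis using that by (intro edge_walk) simp
    qed
    then have "P (T - {{u, v}})"
      using T walk_replace_edges[of _ _ T "T - {{u, v}}"]
      unfolding P_def connected_graph_def by blast
    then show False using min uv \<open>finite T\<close> by (meson card_Diff1_less not_le)
  qed
  moreover have "\<And>u. {u} \<notin> T" using T loopless by (auto simp: P_def)
  ultimately have "T \<in> spanning_trees V E"
    using T tree_graph_iff_all_bridges[of T V] by (simp add: P_def spanning_trees_def)
  then show ?thesis by blast
qed

section \<open>Potentials\<close>

definition potential :: "('a \<Rightarrow> 'a \<Rightarrow> real) \<Rightarrow> 'a set set \<Rightarrow> ('a \<Rightarrow> real) \<Rightarrow> bool" where
  "potential b T y \<longleftrightarrow> (\<forall>u v. {u, v} \<in> T \<longrightarrow> y u - y v = b u v)"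

lemma potential_mono: "potential b T y \<Longrightarrow> F \<subseteq> T \<Longrightarrow> potential b F y"
  unfolding potential_def by blast

lemma potential_differences_eq:
  assumes y: "potential b T y" and z: "potential b T z" and "(u, v) \<in> (adjacency T)\<^sup>*"
  shows "y u - y v = z u - z v"
  using assms(3)
proof (induction rule: rtrancl_induct)
  case (step v w)
  then have "{v, w} \<in> T" by (simp add: adjacency_def)
  then have "y v - y w = z v - z w" using y z by (simp add: potential_def)
  then show ?case using step.IH by linarith
qed simp

text \<open>
  A new edge of a forest joins two components; shifting the potential by a constant on one of
  them realizes the prescribed difference along that edge.
\<close>

lemma forest_potential_exists:
  assumes "finite T" and "all_bridges T" and "\<And>e. e \<in> T \<Longrightarrow> \<exists>u v. e = {u, v}"
    and skew: "\<And>u v. {u, v} \<in> T \<Longrightarrow> b u v = - b v u"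
  shows "\<exists>y. potential b T y"
  using assms
proof (induction T rule: finite_induct)
  case empty
  then show ?case by (simp add: potential_def)
next
  case (insert e F)
  then obtain u v where e: "e = {u, v}" by blast
  have "all_bridges F" using insert.prems(1) all_bridges_subset by blast
  then obtain y where y: "potential b F y" using insert by blast
  have nc: "(u, v) \<notin> (adjacency F)\<^sup>*"
    using all_bridgesD[OF insert.prems(1), of u v] e insert.hyps(2) by simp
  define z where "z x = (if (u, x) \<in> (adjacency F)\<^sup>* then y x + (b u v + y v - y u) else y x)" for x
  have "z p - z q = b p q" if pq: "{p, q} \<in> insert e F" for p q
  proof (cases "{p, q} \<in> F")
    case True
    then have "(u, p) \<in> (adjacency F)\<^sup>* \<longleftrightarrow> (u, q) \<in> (adjacency F)\<^sup>*"
      by (meson edge_walk rtrancl_trans walk_sym)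
    moreover have "y p - y q = b p q" using y True by (simp add: potential_def)
    ultimately show ?thesis by (simp add: z_def)
  next
    case False
    have "z u - z v = b u v" using nc by (simp add: z_def)
    moreover have "b u v = - b v u" using insert.prems(3) e by blast
    moreover have "p = u \<and> q = v \<or> p = v \<and> q = u"
      using False pq e by (auto simp: doubleton_eq_iff)
    ultimately show ?thesis by auto
  qed
  then show ?case unfolding potential_def by blast
qed

section \<open>Exchanging an edge at a vertex\<close>

definition delete_vertex :: "'a \<Rightarrow> 'a set set \<Rightarrow> 'a set set" where
  "delete_vertex i T = {e \<in> T. i \<notin> e}"

text \<open>
  In a tree, the walk from \<open>i\<close> to another vertex \<open>j\<close> leaves \<open>i\<close> along exactly one edge \<open>{i, k}\<close>.
  The vertex \<open>k\<close> is described through the graph without \<open>i\<close> because that graph is unaffected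
  by exchanges of edges at \<open>i\<close>.
\<close>

lemma first_step_exists:
  assumes "(i, j) \<in> (adjacency T)\<^sup>*" and "i \<noteq> j"
  shows "\<exists>k. {i, k} \<in> T \<and> (k, j) \<in> (adjacency (delete_vertex i T))\<^sup>*"
proof -
  have "j = i \<or> (\<exists>k. {i, k} \<in> T \<and> (k, j) \<in> (adjacency (delete_vertex i T))\<^sup>*)"
    using assms(1)
  proof (induction rule: rtrancl_induct)
    case (step v w)
    have vw: "{v, w} \<in> T" using step.hyps by (simp add: adjacency_def)
    show ?case
    proof (cases "w = i \<or> v = i")
      case True
      then show ?thesis using vw by blast
    next
      case False
      then have "{v, w} \<in> delete_vertex i T" using vw by (auto simp: delete_vertex_def)
      then show ?thesis using step.IH False edge_walk by (metis rtrancl_trans)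
    qed
  qed simp
  then show ?thesis using assms(2) by blast
qed

lemma first_step_unique:
  assumes T: "all_bridges T" and k: "{i, k} \<in> T" and l: "{i, l} \<in> T"
    and "(k, j) \<in> (adjacency (delete_vertex i T))\<^sup>*"
    and "(l, j) \<in> (adjacency (delete_vertex i T))\<^sup>*"
  shows "k = l"
proof (rule ccontr)
  assume "k \<noteq> l"
  have "(k, l) \<in> (adjacency (delete_vertex i T))\<^sup>*"
    using assms(4,5) walk_sym by (meson rtrancl_trans)
  then have "(k, l) \<in> (adjacency (T - {{i, k}}))\<^sup>*"
    by (rule walk_mono) (auto simp: delete_vertex_def)
  moreover have "(i, l) \<in> (adjacency (T - {{i, k}}))\<^sup>*"
    using l \<open>k \<noteq> l\<close> by (intro edge_walk) (auto simp: doubleton_eq_iff)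
  ultimately have "(i, k) \<in> (adjacency (T - {{i, k}}))\<^sup>*"
    using walk_sym by (meson rtrancl_trans)
  then show False using all_bridgesD[OF T k] by simp
qed

definition exchange_edge :: "'a \<Rightarrow> 'a \<Rightarrow> 'a \<Rightarrow> 'a set set \<Rightarrow> 'a set set" where
  "exchange_edge i k j T = insert {i, j} (T - {{i, k}})"

lemma delete_vertex_exchange_edge [simp]:
  "delete_vertex i (exchange_edge i k j T) = delete_vertex i T"
  by (auto simp: delete_vertex_def exchange_edge_def)

text \<open>
  Removing \<open>{i, k}\<close> separates \<open>i\<close> from the component of \<open>k\<close>.  That component contains \<open>j\<close>, so
  \<open>{i, j}\<close> joins the two parts again without closing a cycle.
\<close>

lemma exchange_edge_spanning_tree:
  assumes loopless: "\<And>u. {u} \<notin> E" and T: "T \<in> spanning_trees V E"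
    and k: "{i, k} \<in> T" and j: "{i, j} \<in> E"
    and kj: "(k, j) \<in> (adjacency (delete_vertex i T))\<^sup>*"
  shows "exchange_edge i k j T \<in> spanning_trees V E"
proof -
  let ?T' = "exchange_edge i k j T"
  have TE: "T \<subseteq> E" and conn: "connected_graph V T" and br: "all_bridges T"
    using T tree_graph_iff_all_bridges[of T V] loopless by (auto simp: spanning_trees_def)
  have T'E: "?T' \<subseteq> E" using TE j by (auto simp: exchange_edge_def)
  have "(i, k) \<in> (adjacency ?T')\<^sup>*"
  proof -
    have "(k, j) \<in> (adjacency ?T')\<^sup>*"
      by (rule walk_mono[OF kj]) (auto simp: delete_vertex_def exchange_edge_def)
    moreover have "(i, j) \<in> (adjacency ?T')\<^sup>*"
      by (rule edge_walk) (simp add: exchange_edge_def)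
    ultimately show ?thesis using walk_sym by (meson rtrancl_trans)
  qed
  then have "(x, y) \<in> (adjacency ?T')\<^sup>*" if "{x, y} \<in> T" for x y
    using that walk_sym edge_walk[of x y ?T']
    by (cases "{x, y} = {i, k}") (auto simp: exchange_edge_def doubleton_eq_iff)
  then have "connected_graph V ?T'"
    using conn walk_replace_edges[of _ _ T ?T'] unfolding connected_graph_def by blast
  moreover have "all_bridges ?T'"
    unfolding exchange_edge_def
  proof (rule all_bridges_insert)
    show "all_bridges (T - {{i, k}})" by (rule all_bridges_subset[OF br]) blast
    show "(i, j) \<notin> (adjacency (T - {{i, k}}))\<^sup>*"
    proof
      assume ij: "(i, j) \<in> (adjacency (T - {{i, k}}))\<^sup>*"
      have "(k, j) \<in> (adjacency (T - {{i, k}}))\<^sup>*"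
        by (rule walk_mono[OF kj]) (auto simp: delete_vertex_def)
      then have "(i, k) \<in> (adjacency (T - {{i, k}}))\<^sup>*"
        using ij walk_sym by (meson rtrancl_trans)
      then show False using all_bridgesD[OF br k] by simp
    qed
  qed
  moreover have "\<And>u. {u} \<notin> ?T'" using T'E loopless by blast
  ultimately show ?thesis
    using T'E tree_graph_iff_all_bridges[of ?T' V] by (simp add: spanning_trees_def)
qed

text \<open>
  If the tree walk from \<open>i\<close> to \<open>j\<close> starts with \<open>{i, k}\<close> and \<open>j \<noteq> k\<close>, exchanging \<open>{i, k}\<close> for \<open>{i, j}\<close> keeps the
  graph \<open>T + {i, j}\<close> with its only cycle, but that cycle is now closed by \<open>{i, k}\<close>.  The two
  residuals are the sums of \<open>b\<close> around this cycle in its two directions.  The proof compares \<open>y\<close> and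
  \<open>z\<close> on the part of the cycle that avoids \<open>i\<close>, where both are potentials of the same edges.
\<close>

lemma exchange_edge_residual:
  assumes y: "potential b T y" and z: "potential b (exchange_edge i k j T) z"
    and k: "{i, k} \<in> T" and kj: "(k, j) \<in> (adjacency (delete_vertex i T))\<^sup>*"
  shows "b i k - z i + z k = - (b i j - y i + y j)"
proof -
  have "potential b (delete_vertex i T) y"
    by (rule potential_mono[OF y]) (auto simp: delete_vertex_def)
  moreover have "potential b (delete_vertex i T) z"
    by (rule potential_mono[OF z]) (auto simp: delete_vertex_def exchange_edge_def)
  ultimately have "y k - y j = z k - z j"
    using kj by (rule potential_differences_eq)
  moreover have "y i - y k = b i k" using y k by (simp add: potential_def)
  moreover have "z i - z j = b i j" using z by (simp add: potential_def exchange_edge_def)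
  ultimately show ?thesis by linarith
qed

text \<open>
  The sum runs over pairs \<open>(T, j)\<close>.  Each of them determines the first step \<open>k\<close> of the walk in \<open>T\<close>
  from \<open>i\<close> to \<open>j\<close>, and on the triples \<open>(T, k, j)\<close> the exchange is an explicit involution that
  reverses the sign of the residual.  The case \<open>{i, j} \<in> T\<close> is included: then \<open>k = j\<close>, the triple is
  a fixed point, and its residual is \<open>0\<close>.
\<close>

lemma sum_tree_residuals_eq_0:
  fixes y :: "'a set set \<Rightarrow> 'a \<Rightarrow> real"
  assumes loopless: "\<And>u. {u} \<notin> E" and ends: "\<And>u v. {u, v} \<in> E \<Longrightarrow> u \<in> V \<and> v \<in> V"
    and y: "\<And>T. T \<in> spanning_trees V E \<Longrightarrow> potential b T (y T)"
  shows "(\<Sum>(T, j)\<in>spanning_trees V E \<times> {j. {i, j} \<in> E}. b i j - y T i + y T j) = 0"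
proof -
  define r where "r T j = b i j - y T i + y T j" for T j
  define P where "P = {(T, k, j). T \<in> spanning_trees V E \<and> {i, k} \<in> T \<and> {i, j} \<in> E \<and>
    (k, j) \<in> (adjacency (delete_vertex i T))\<^sup>*}"
  have tree: "T \<subseteq> E" "connected_graph V T" "all_bridges T" if "T \<in> spanning_trees V E" for T
    using that tree_graph_iff_all_bridges[of T V] loopless by (auto simp: spanning_trees_def)
  define swap where "swap = (\<lambda>(T, k, j). (exchange_edge i k j T, j, k))"
  have swap_in: "swap p \<in> P" if "p \<in> P" for p
  proof -
    obtain T k j where p: "p = (T, k, j)" by (cases p)
    have m: "T \<in> spanning_trees V E" "{i, k} \<in> T" "{i, j} \<in> E"
      "(k, j) \<in> (adjacency (delete_vertex i T))\<^sup>*"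
      using that p by (auto simp: P_def)
    show ?thesis
      using exchange_edge_spanning_tree[OF loopless m] m walk_sym[OF m(4)] tree(1)[OF m(1)]
      by (auto simp: p swap_def P_def) (simp add: exchange_edge_def)
  qed
  have swap_swap: "swap (swap p) = p" if "p \<in> P" for p
  proof -
    obtain T k j where p: "p = (T, k, j)" by (cases p)
    have m: "T \<in> spanning_trees V E" "{i, k} \<in> T"
      "(k, j) \<in> (adjacency (delete_vertex i T))\<^sup>*"
      using that p by (auto simp: P_def)
    have "k = j" if "{i, j} \<in> T"
      using first_step_unique[OF tree(3)[OF m(1)] m(2) that m(3)] by blast
    then have "exchange_edge i j k (exchange_edge i k j T) = T"
      using m(2) by (auto simp: exchange_edge_def)
    then show ?thesis by (simp add: p swap_def)
  qed
  have "(\<Sum>(T, k, j)\<in>P. r T j) = (\<Sum>(T, k, j)\<in>P. - r T j)"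
  proof (rule sum.reindex_bij_witness[where i = swap and j = swap])
    fix p assume p: "p \<in> P"
    obtain T k j where q: "p = (T, k, j)" by (cases p)
    have m: "T \<in> spanning_trees V E" "{i, k} \<in> T" "{i, j} \<in> E"
      "(k, j) \<in> (adjacency (delete_vertex i T))\<^sup>*"
      using p q by (auto simp: P_def)
    show "(case swap p of (T, k, j) \<Rightarrow> - r T j) = (case p of (T, k, j) \<Rightarrow> r T j)"
      using exchange_edge_residual[OF y[OF m(1)] y[OF exchange_edge_spanning_tree[OF loopless m]]
          m(2,4)]
      by (simp add: q swap_def r_def)
  qed (use swap_in swap_swap in auto)
  then have "(\<Sum>(T, k, j)\<in>P. r T j) = 0"
    by (simp add: sum_negf split_def)
  moreover have "(\<Sum>(T, k, j)\<in>P. r T j) = (\<Sum>(T, j)\<in>spanning_trees V E \<times> {j. {i, j} \<in> E}. r T j)"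
  proof -
    define proj where "proj = (\<lambda>(T :: 'a set set, k :: 'a, j :: 'a). (T, j))"
    have "inj_on proj P"
    proof (rule inj_onI)
      fix p q assume pq: "p \<in> P" "q \<in> P" "proj p = proj q"
      obtain T k j where p: "p = (T, k, j)" by (cases p)
      obtain l where q: "q = (T, l, j)" using pq(3) by (cases q) (simp add: p proj_def)
      show "p = q"
        using pq(1,2) first_step_unique[of T i k l j] tree(3) by (auto simp: p q P_def)
    qed
    moreover have "proj ` P = spanning_trees V E \<times> {j. {i, j} \<in> E}"
    proof (intro equalityI subsetI)
      fix q assume "q \<in> spanning_trees V E \<times> {j. {i, j} \<in> E}"
      then obtain T j where q: "q = (T, j)" "T \<in> spanning_trees V E" "{i, j} \<in> E" by auto
      have "i \<noteq> j" using q(3) loopless[of i] by auto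
      moreover have "(i, j) \<in> (adjacency T)\<^sup>*"
        using tree(2)[OF q(2)] ends[OF q(3)] by (simp add: connected_graph_def)
      ultimately obtain k where "{i, k} \<in> T" "(k, j) \<in> (adjacency (delete_vertex i T))\<^sup>*"
        using first_step_exists by metis
      then have "(T, k, j) \<in> P" using q by (simp add: P_def)
      moreover have "proj (T, k, j) = q" by (simp add: q proj_def)
      ultimately show "q \<in> proj ` P" by (metis imageI)
    qed (auto simp: P_def proj_def)
    ultimately show ?thesis
      by (intro sum.reindex_cong[of proj, symmetric]) (auto simp: proj_def)
  qed
  ultimately show ?thesis by (simp add: r_def)
qed

section \<open>The normal equations\<close>

text \<open>
  With \<open>d = y - z\<close> and the residuals \<open>r\<close> of \<open>z\<close>, the mixed terms of the expanded squares are
  multiples of \<open>r i j * (d i - d j)\<close>.  By the normal equations the terms with \<open>d i\<close> sum to \<open>0\<close>, and the terms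
  with \<open>d j\<close> have the same sum because \<open>r\<close> is skew-symmetric.
\<close>

lemma sum_squares_decomposition:
  fixes b :: "'a \<Rightarrow> 'a \<Rightarrow> real"
  assumes "finite A" and "sym A"
    and skew: "\<And>i j. (i, j) \<in> A \<Longrightarrow> b i j = - b j i"
    and normal: "\<And>i. i \<in> Domain A \<Longrightarrow> (\<Sum>j\<in>A `` {i}. b i j - z i + z j) = 0"
  shows "(\<Sum>(i, j)\<in>A. (b i j - y i + y j)\<^sup>2) =
    (\<Sum>(i, j)\<in>A. (b i j - z i + z j)\<^sup>2) + (\<Sum>(i, j)\<in>A. ((y i - z i) - (y j - z j))\<^sup>2)"
proof -
  define d where "d i = y i - z i" for i
  define r where "r i j = b i j - z i + z j" for i j
  have A: "A = Sigma (Domain A) (\<lambda>i. A `` {i})" by auto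
  have fin: "finite (Domain A)" "finite (A `` {i})" for i
    using assms(1) by (auto simp: finite_Domain intro: finite_Image)
  have "(\<Sum>(i, j)\<in>A. r i j * d i) = (\<Sum>i\<in>Domain A. \<Sum>j\<in>A `` {i}. r i j * d i)"
    by (subst A, rule sum.Sigma[symmetric]) (use fin in auto)
  also have "\<dots> = 0"
    using normal by (intro sum.neutral) (auto simp: r_def simp flip: sum_distrib_right)
  finally have 1: "(\<Sum>(i, j)\<in>A. r i j * d i) = 0" .
  have "(\<Sum>(i, j)\<in>A. r i j * d j) = (\<Sum>(i, j)\<in>A. - (r i j * d i))"
  proof (rule sum.reindex_bij_witness[where i = prod.swap and j = prod.swap])
    fix p assume "p \<in> A"
    moreover obtain i j where p: "p = (i, j)" by (cases p)
    ultimately have "b i j = - b j i" using skew by simp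
    then have "r i j = - r j i" by (simp add: r_def)
    then show "(case prod.swap p of (i, j) \<Rightarrow> - (r i j * d i)) = (case p of (i, j) \<Rightarrow> r i j * d j)"
      by (simp add: p)
  qed (use assms(2) in \<open>auto dest: symD\<close>)
  also have "\<dots> = 0" using 1 by (simp add: sum_negf split_def)
  finally have 2: "(\<Sum>(i, j)\<in>A. r i j * d j) = 0" .
  have "(\<Sum>(i, j)\<in>A. (b i j - y i + y j)\<^sup>2) =
    (\<Sum>(i, j)\<in>A. (r i j)\<^sup>2 + (d i - d j)\<^sup>2 - 2 * (r i j * d i) + 2 * (r i j * d j))"
    by (intro sum.cong refl)
      (auto simp: r_def d_def power2_eq_square algebra_simps)
  also have "\<dots> = (\<Sum>(i, j)\<in>A. (r i j)\<^sup>2) + (\<Sum>(i, j)\<in>A. (d i - d j)\<^sup>2)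
    - 2 * (\<Sum>(i, j)\<in>A. r i j * d i) + 2 * (\<Sum>(i, j)\<in>A. r i j * d j)"
    by (simp add: split_def sum.distrib sum_subtractf sum_distrib_left)
  finally show ?thesis using 1 2 by (simp add: r_def d_def)
qed

section \<open>Pairwise comparison matrices\<close>

lemma pcm_edges_iff:
  assumes "additive_pcm n B"
  shows "{i, j} \<in> pcm_edges n B \<longleftrightarrow> i \<in> {1..n} \<and> j \<in> {1..n} \<and> i \<noteq> j \<and> B i j \<noteq> None"
proof -
  have "B k l \<noteq> None \<longleftrightarrow> B l k \<noteq> None" if "k \<in> {1..n}" "l \<in> {1..n}" for k l
    using assms that unfolding additive_pcm_def by blast
  then show ?thesis unfolding pcm_edges_def mem_Collect_eq doubleton_eq_iff by blast
qed

lemma finite_pcm_edges: "finite (pcm_edges n B)"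
  by (rule finite_subset[of _ "Pow {1..n}"]) (auto simp: pcm_edges_def)

lemma additive_pcm_skew:
  assumes "additive_pcm n B" "i \<in> {1..n}" "j \<in> {1..n}" "B i j \<noteq> None"
  shows "the (B i j) = - the (B j i)"
proof -
  have "B j i \<noteq> None" using assms unfolding additive_pcm_def by blast
  then show ?thesis using assms unfolding additive_pcm_def by auto
qed

lemma is_tree_weight_vector_iff:
  assumes "additive_pcm n B" and "T \<subseteq> pcm_edges n B"
  shows "is_tree_weight_vector n B T y \<longleftrightarrow>
    y \<in> normalized_vectors n \<and> potential (\<lambda>i j. the (B i j)) T y"
proof -
  have "B i j = Some c \<longleftrightarrow> c = the (B i j)" if "{i, j} \<in> T" for i j c
  proof -
    have "B i j \<noteq> None" using that assms pcm_edges_iff by blast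
    then show ?thesis by auto
  qed
  then show ?thesis unfolding is_tree_weight_vector_def potential_def by blast
qed

lemma ex1_tree_weight_vector:
  assumes n: "n \<ge> 1" and B: "additive_pcm n B" and T: "T \<in> pcm_trees n B"
  shows "\<exists>!y. is_tree_weight_vector n B T y"
proof -
  let ?b = "\<lambda>i j. the (B i j)"
  have TE: "T \<subseteq> pcm_edges n B" using T by (simp add: spanning_trees_def)
  have ends: "i \<in> {1..n} \<and> j \<in> {1..n} \<and> i \<noteq> j \<and> B i j \<noteq> None" if "{i, j} \<in> T" for i j
    using that TE pcm_edges_iff[OF B] by blast
  have "{i} \<notin> T" for i using ends[of i i] by auto
  then have conn: "connected_graph {1..n} T" and br: "all_bridges T"
    using T tree_graph_iff_all_bridges[of T "{1..n}"] by (auto simp: spanning_trees_def)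
  have "\<exists>y. potential ?b T y"
  proof (rule forest_potential_exists[OF _ br])
    show "finite T" using TE finite_pcm_edges by (rule finite_subset)
    show "\<exists>u v. e = {u, v}" if "e \<in> T" for e
      using that TE unfolding pcm_edges_def by blast
    show "?b i j = - ?b j i" if "{i, j} \<in> T" for i j
      using ends[OF that] additive_pcm_skew[OF B] by blast
  qed
  then obtain y where y: "potential ?b T y" ..
  let ?y = "\<lambda>i\<in>{1..n}. y i - y 1"
  show ?thesis
  proof (rule ex1I)
    have "potential ?b T ?y"
      using y ends unfolding potential_def by auto
    then show "is_tree_weight_vector n B T ?y"
      using n by (simp add: is_tree_weight_vector_iff[OF B TE] normalized_vectors_def)
  next
    fix z assume "is_tree_weight_vector n B T z"
    then have z: "z \<in> {1..n} \<rightarrow>\<^sub>E UNIV" "z 1 = 0" "potential ?b T z"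
      by (auto simp: is_tree_weight_vector_iff[OF B TE] normalized_vectors_def)
    show "z = ?y"
    proof (rule PiE_ext[OF z(1)])
      fix i assume i: "i \<in> {1..n}"
      then have "(i, 1) \<in> (adjacency T)\<^sup>*"
        using conn n by (simp add: connected_graph_def)
      then show "z i = ?y i"
        using potential_differences_eq[OF z(3) y] z(2) i by fastforce
    qed simp
  qed
qed

definition mean_tree_weight_vector :: "nat \<Rightarrow> incomplete_matrix \<Rightarrow> nat \<Rightarrow> real" where
  "mean_tree_weight_vector n B = (\<lambda>i\<in>{1..n}. 1 / real (card (pcm_trees n B)) *
     (\<Sum>T\<in>pcm_trees n B. tree_weight_vector n B T i))"

lemma tree_weight_vector:
  assumes "n \<ge> 1" and "additive_pcm n B" and "T \<in> pcm_trees n B"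
  shows "tree_weight_vector n B T \<in> normalized_vectors n"
    and "potential (\<lambda>i j. the (B i j)) T (tree_weight_vector n B T)"
  using theI'[OF ex1_tree_weight_vector[OF assms]] assms(2,3)
  by (auto simp: tree_weight_vector_def[symmetric] is_tree_weight_vector_iff spanning_trees_def)

lemma mean_tree_weight_vector_normalized:
  assumes "n \<ge> 1" and "additive_pcm n B"
  shows "mean_tree_weight_vector n B \<in> normalized_vectors n"
  using assms tree_weight_vector(1)[OF assms]
  by (auto simp: normalized_vectors_def mean_tree_weight_vector_def)

text \<open>
  The residual is affine in the vector, so the residual of the mean is the mean of the residuals.
  The sum also contains the diagonal entry \<open>j = i\<close>, which contributes \<open>0\<close>.  That there is a
  spanning tree matters here, since the mean over no vectors would be \<open>0\<close>.
\<close>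

lemma mean_tree_weight_vector_normal_equations:
  assumes n: "n \<ge> 1" and B: "additive_pcm n B" and conn: "connected_graph {1..n} (pcm_edges n B)"
    and i: "i \<in> {1..n}"
  shows "(\<Sum>j\<in>{j\<in>{1..n}. B i j \<noteq> None}. the (B i j) -
    mean_tree_weight_vector n B i + mean_tree_weight_vector n B j) = 0"
proof -
  let ?E = "pcm_edges n B" and ?S = "pcm_trees n B" and ?z = "mean_tree_weight_vector n B"
  let ?y = "tree_weight_vector n B" and ?b = "\<lambda>i j. the (B i j)"
  define N where "N = {j. {i, j} \<in> ?E}"
  have loopless: "{u} \<notin> ?E" for u using pcm_edges_iff[OF B, of u u] by simp
  have N: "{j\<in>{1..n}. B i j \<noteq> None} = insert i N" "i \<notin> N" "N \<subseteq> {1..n}"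
    using B i by (auto simp: N_def pcm_edges_iff[OF B] additive_pcm_def)
  have "finite N" using N(3) by (rule finite_subset) simp
  have "finite ?S"
    by (rule finite_subset[of _ "Pow ?E"]) (auto simp: spanning_trees_def finite_pcm_edges)
  moreover have "?S \<noteq> {}"
    using spanning_tree_exists[OF finite_pcm_edges loopless conn] .
  ultimately have S: "real (card ?S) \<noteq> 0" by simp
  have z: "real (card ?S) * ?z j = (\<Sum>T\<in>?S. ?y T j)" if "j \<in> {1..n}" for j
    using that S by (simp add: mean_tree_weight_vector_def)
  have "real (card ?S) * (\<Sum>j\<in>N. ?b i j - ?z i + ?z j) =
    (\<Sum>j\<in>N. \<Sum>T\<in>?S. ?b i j - ?y T i + ?y T j)"
    unfolding sum_distrib_left
  proof (rule sum.cong[OF refl])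
    fix j assume "j \<in> N"
    then have "j \<in> {1..n}" using N by blast
    then show "real (card ?S) * (?b i j - ?z i + ?z j) = (\<Sum>T\<in>?S. ?b i j - ?y T i + ?y T j)"
      using z[of j] z[OF i] by (simp add: sum.distrib sum_subtractf algebra_simps)
  qed
  also have "\<dots> = (\<Sum>(T, j)\<in>?S \<times> N. ?b i j - ?y T i + ?y T j)"
    by (subst sum.swap, rule sum.cartesian_product)
  also have "\<dots> = 0"
    unfolding N_def
    by (rule sum_tree_residuals_eq_0)
      (use loopless pcm_edges_iff[OF B] tree_weight_vector(2)[OF n B] in auto)
  finally have "(\<Sum>j\<in>N. ?b i j - ?z i + ?z j) = 0" using S by simp
  moreover have "?b i i = 0" using B i by (simp add: additive_pcm_def)
  ultimately show ?thesis using N \<open>finite N\<close> by simp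
qed

lemma ls_solution_iff_mean:
  assumes n: "n \<ge> 1" and B: "additive_pcm n B" and conn: "connected_graph {1..n} (pcm_edges n B)"
  shows "is_ls_solution n B y \<longleftrightarrow> y = mean_tree_weight_vector n B"
proof -
  let ?z = "mean_tree_weight_vector n B" and ?b = "\<lambda>i j. the (B i j)"
  define A where "A = {(i, j). i \<in> {1..n} \<and> j \<in> {1..n} \<and> B i j \<noteq> None}"
  have fin: "finite A"
    by (rule finite_subset[of _ "{1..n} \<times> {1..n}"]) (auto simp: A_def)
  have obj: "ls_objective n B y = (\<Sum>(i, j)\<in>A. (?b i j - y i + y j)\<^sup>2)" for y
    by (simp add: ls_objective_def A_def)
  have zn: "?z \<in> normalized_vectors n"
    using mean_tree_weight_vector_normalized[OF n B] .
  define Q where "Q y = (\<Sum>(i, j)\<in>A. ((y i - ?z i) - (y j - ?z j))\<^sup>2)" for y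
  have dec: "ls_objective n B y = ls_objective n B ?z + Q y" for y
    unfolding obj Q_def
  proof (rule sum_squares_decomposition[OF fin])
    show "sym A" using B by (auto simp: sym_def A_def additive_pcm_def)
    show "?b i j = - ?b j i" if "(i, j) \<in> A" for i j
      using that additive_pcm_skew[OF B, of i j] by (simp add: A_def)
    show "(\<Sum>j\<in>A `` {i}. ?b i j - ?z i + ?z j) = 0" if "i \<in> Domain A" for i
    proof -
      have "i \<in> {1..n}" "A `` {i} = {j\<in>{1..n}. B i j \<noteq> None}"
        using that by (auto simp: A_def)
      then show ?thesis using mean_tree_weight_vector_normal_equations[OF n B conn] by simp
    qed
  qed
  have Q_nonneg: "Q y \<ge> 0" for y unfolding Q_def by (intro sum_nonneg) auto
  have unique: "y = ?z" if y: "y \<in> normalized_vectors n" and "Q y = 0" for y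
  proof -
    have const: "y i - ?z i = y j - ?z j" if "(i, j) \<in> A" for i j
    proof -
      have "\<forall>p\<in>A. (case p of (i, j) \<Rightarrow> ((y i - ?z i) - (y j - ?z j))\<^sup>2) = 0"
        using \<open>Q y = 0\<close> unfolding Q_def by (subst (asm) sum_nonneg_eq_0_iff[OF fin]) auto
      then show ?thesis using that by fastforce
    qed
    \<comment> \<open>Two potentials of the same matrix agree up to a constant on a connected graph; the matrix
      used for this is the one of the differences of \<open>?z\<close>.\<close>
    have "potential (\<lambda>i j. ?z i - ?z j) (pcm_edges n B) y"
      unfolding potential_def
    proof (intro allI impI)
      fix i j assume "{i, j} \<in> pcm_edges n B"
      then have "(i, j) \<in> A" by (simp add: A_def pcm_edges_iff[OF B])
      from const[OF this] show "y i - y j = ?z i - ?z j" by linarith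
    qed
    moreover have "potential (\<lambda>i j. ?z i - ?z j) (pcm_edges n B) ?z"
      by (simp add: potential_def)
    ultimately have diff: "y i - y 1 = ?z i - ?z 1" if "i \<in> {1..n}" for i
      using potential_differences_eq that conn n unfolding connected_graph_def
      by (metis atLeastAtMost_iff order_refl)
    show "y = ?z"
    proof (rule PiE_ext)
      show "y \<in> {1..n} \<rightarrow>\<^sub>E UNIV" "?z \<in> {1..n} \<rightarrow>\<^sub>E UNIV"
        using y zn by (auto simp: normalized_vectors_def)
      show "y i = ?z i" if "i \<in> {1..n}" for i
        using diff[OF that] y zn by (simp add: normalized_vectors_def)
    qed
  qed
  show ?thesis
  proof
    assume "is_ls_solution n B y"
    then have y: "y \<in> normalized_vectors n" and "\<not> ls_objective n B ?z < ls_objective n B y"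
      using zn by (auto simp: is_ls_solution_def is_arg_min_def)
    then have "Q y = 0" using dec[of y] Q_nonneg[of y] by linarith
    with y show "y = ?z" by (rule unique)
  next
    assume "y = ?z"
    moreover have "\<not> ls_objective n B x < ls_objective n B ?z" for x
      using dec[of x] Q_nonneg[of x] by linarith
    ultimately show "is_ls_solution n B y"
      using zn by (simp add: is_ls_solution_def is_arg_min_def)
  qed
qed

theorem theorem2p2:
  fixes n :: nat and B :: incomplete_matrix
  assumes "n \<ge> 1"
    and "additive_pcm n B"
    and "connected_graph {1..n} (pcm_edges n B)"
  shows "(\<forall>T\<in>pcm_trees n B. \<exists>!y. is_tree_weight_vector n B T y) \<and>
         (\<exists>!y. is_ls_solution n B y) \<and>
         ls_solution n B =
           (\<lambda>i\<in>{1..n}. 1 / real (card (pcm_trees n B)) * (\<Sum>T\<in>pcm_trees n B. tree_weight_vector n B T i))"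
  unfolding mean_tree_weight_vector_def[symmetric]
  using ex1_tree_weight_vector[OF assms(1,2)] ls_solution_iff_mean[OF assms]
  by (simp add: ls_solution_def)

end
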